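(* Let $p\ge 2$ be an integer and let $\zeta\in\mathbb C$ be a primitive $p$-th root of unity. If $u$ and $v$ are $d\times d$ complex unitary matrices such that $u^p=v^p=1_d$ and $uv=\zeta vu$, then the pair $(u,v)$ is universal for all pairs of $p$-th order unitary matrices that satisfy the Weyl commutation relation; that is, for every $d'\in\mathbb N$ and all $d'\times d'$ complex unitary matrices $u'$ and $v'$ such that $(u')^p=(v')^p=1_{d'}$ and $u'v'=\zeta v'u'$, there exists a unital completely positive linear map $\Phi:M_d(\mathbb C)\to M_{d'}(\mathbb C)$ such that $\Phi(u)=u'$ and $\Phi(v)=v'$.
   Context: $M_n(\mathbb C)$ is the algebra of complex $n\times n$ matrices with identity $1_n$. A unitary matrix $w$ is of $p$-th order if $w^p$ is the identity matrix. The Weyl commutation relation is $uv=\zeta vu$. *)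

theory Defs
  imports "Jordan_Normal_Form.Schur_Decomposition"
begin

text \<open>\<open>M\<^sub>n(\<complex>)\<close> is \<open>carrier_mat n n :: complex mat set\<close>.\<close>

definition primitive_root_of_unity :: "nat \<Rightarrow> complex \<Rightarrow> bool" where
  "primitive_root_of_unity p \<zeta> \<longleftrightarrow> 0 < p \<and> \<zeta> ^ p = 1 \<and> (\<forall>k. 0 < k \<and> k < p \<longrightarrow> \<zeta> ^ k \<noteq> 1)"

definition unitary_mat :: "nat \<Rightarrow> complex mat \<Rightarrow> bool" where
  "unitary_mat n U \<longleftrightarrow> U \<in> carrier_mat n n \<and> mat_adjoint U * U = 1\<^sub>m n \<and> U * mat_adjoint U = 1\<^sub>m n"

text \<open>The order \<open>\<le>\<close> on \<open>complex\<close> below is that of \<open>HOL-Library.Complex_Order\<close>: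
  \<open>0 \<le> z\<close> says that \<open>z\<close> is real and nonnegative.\<close>

definition pos_semidef_mat :: "nat \<Rightarrow> complex mat \<Rightarrow> bool" where
  "pos_semidef_mat n X \<longleftrightarrow>
     X \<in> carrier_mat n n \<and> mat_adjoint X = X \<and> (\<forall>x \<in> carrier_vec n. 0 \<le> (X *\<^sub>v x) \<bullet>c x)"

definition linear_mat_map :: "nat \<Rightarrow> nat \<Rightarrow> (complex mat \<Rightarrow> complex mat) \<Rightarrow> bool" where
  "linear_mat_map n m \<Phi> \<longleftrightarrow>
     (\<forall>X \<in> carrier_mat n n. \<Phi> X \<in> carrier_mat m m) \<and>
     (\<forall>X \<in> carrier_mat n n. \<forall>Y \<in> carrier_mat n n. \<Phi> (X + Y) = \<Phi> X + \<Phi> Y) \<and>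
     (\<forall>c. \<forall>X \<in> carrier_mat n n. \<Phi> (c \<cdot>\<^sub>m X) = c \<cdot>\<^sub>m \<Phi> X)"

text \<open>We identify \<open>M\<^sub>k(M\<^sub>n(\<complex>))\<close> with \<open>M\<^bsub>kn\<^esub>(\<complex>)\<close>, a matrix being split into \<open>k \<times> k\<close> blocks
  of size \<open>n \<times> n\<close>. Then \<open>mat_block n X i j\<close> is the \<open>(i, j)\<close>-th block of \<open>X\<close>, and
  \<open>ampliation k n m \<Phi>\<close> is the map \<open>[X\<^sub>i\<^sub>j] \<mapsto> [\<Phi>(X\<^sub>i\<^sub>j)]\<close> from \<open>M\<^sub>k(M\<^sub>n(\<complex>))\<close> to \<open>M\<^sub>k(M\<^sub>m(\<complex>))\<close>.\<close>

definition mat_block :: "nat \<Rightarrow> complex mat \<Rightarrow> nat \<Rightarrow> nat \<Rightarrow> complex mat" where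
  "mat_block n X i j = mat n n (\<lambda>(r, s). X $$ (i * n + r, j * n + s))"

definition ampliation ::
  "nat \<Rightarrow> nat \<Rightarrow> nat \<Rightarrow> (complex mat \<Rightarrow> complex mat) \<Rightarrow> complex mat \<Rightarrow> complex mat" where
  "ampliation k n m \<Phi> X =
     mat (k * m) (k * m) (\<lambda>(a, b). \<Phi> (mat_block n X (a div m) (b div m)) $$ (a mod m, b mod m))"

definition completely_positive :: "nat \<Rightarrow> nat \<Rightarrow> (complex mat \<Rightarrow> complex mat) \<Rightarrow> bool" where
  "completely_positive n m \<Phi> \<longleftrightarrow>
     (\<forall>k X. pos_semidef_mat (k * n) X \<longrightarrow> pos_semidef_mat (k * m) (ampliation k n m \<Phi> X))"

definition ucp_map :: "nat \<Rightarrow> nat \<Rightarrow> (complex mat \<Rightarrow> complex mat) \<Rightarrow> bool" where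
  "ucp_map n m \<Phi> \<longleftrightarrow> linear_mat_map n m \<Phi> \<and> \<Phi> (1\<^sub>m n) = 1\<^sub>m m \<and> completely_positive n m \<Phi>"

definition weyl_pair :: "nat \<Rightarrow> complex \<Rightarrow> nat \<Rightarrow> complex mat \<Rightarrow> complex mat \<Rightarrow> bool" where
  "weyl_pair p \<zeta> n u v \<longleftrightarrow>
     unitary_mat n u \<and> unitary_mat n v \<and> u ^\<^sub>m p = 1\<^sub>m n \<and> v ^\<^sub>m p = 1\<^sub>m n \<and>
     u * v = \<zeta> \<cdot>\<^sub>m (v * u)"

definition universal_for_weyl_pairs ::
  "nat \<Rightarrow> complex \<Rightarrow> nat \<Rightarrow> complex mat \<Rightarrow> complex mat \<Rightarrow> bool" where
  "universal_for_weyl_pairs p \<zeta> d u v \<longleftrightarrow>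
     (\<forall>d' u' v'. weyl_pair p \<zeta> d' u' v' \<longrightarrow>
        (\<exists>\<Phi>. ucp_map d d' \<Phi> \<and> \<Phi> u = u' \<and> \<Phi> v = v'))"

end

theory Submission
  imports Defs
begin

text \<open>The monomials \<open>w\<^sub>k\<^sub>l = v\<^sup>k u\<^sup>l\<close> with \<open>k, l < p\<close> are orthogonal for the trace inner product: conjugation
  by \<open>u\<close> and by \<open>v\<close> multiplies \<open>w\<^sub>k\<^sub>l\<close> by powers of \<open>\<zeta>\<close> that together determine \<open>(k, l)\<close>. With \<open>w'\<^sub>k\<^sub>l\<close> the
  corresponding monomials in \<open>u'\<close> and \<open>v'\<close>, the map
  \<open>\<Phi>(X) = (d p\<^sup>2)\<^sup>-\<^sup>1 \<Sum>\<^bsub>g,h\<^esub> tr(w\<^sub>g\<^sup>* X w\<^sub>h) w'\<^sub>g w'\<^sub>h\<^sup>*\<close> is manifestly completely positive. Left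
  multiplication by \<open>u\<close> and by \<open>v\<close> permutes the monomials up to scalars, and these scalars are the
  same for \<open>u'\<close> and \<open>v'\<close>; so orthogonality collapses \<open>\<Phi>(u)\<close> to \<open>p\<^sup>-\<^sup>2 \<Sum>\<^sub>h u' w'\<^sub>h w'\<^sub>h\<^sup>* = u'\<close>, and
  likewise \<open>\<Phi>(v) = v'\<close> and \<open>\<Phi>(1) = 1\<close>.\<close>

section \<open>Adjoints and entrywise product formulas\<close>

lemma index_mat_adjoint:
  fixes A :: "complex mat"
  assumes "i < dim_col A" and "j < dim_row A"
  shows "mat_adjoint A $$ (i, j) = cnj (A $$ (j, i))"
  using assms unfolding mat_adjoint_def by (simp add: mat_of_rows_index conjugate_complex_def)

lemma dim_mat_adjoint [simp]:
  fixes A :: "complex mat"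
  shows "dim_row (mat_adjoint A) = dim_col A" and "dim_col (mat_adjoint A) = dim_row A"
  unfolding mat_adjoint_def by simp_all

lemma mat_adjoint_carrier [simp]:
  fixes A :: "complex mat"
  shows "A \<in> carrier_mat n m \<Longrightarrow> mat_adjoint A \<in> carrier_mat m n"
  by (auto intro: carrier_matI)

lemma mat_adjoint_adjoint [simp]:
  fixes A :: "complex mat"
  shows "mat_adjoint (mat_adjoint A) = A"
  by (intro eq_matI) (simp_all add: index_mat_adjoint)

lemma index_mult_mat_sum:
  fixes A B :: "'a :: semiring_0 mat"
  assumes "A \<in> carrier_mat a b" and "B \<in> carrier_mat b c" and "i < a" and "j < c"
  shows "(A * B) $$ (i, j) = (\<Sum>l<b. A $$ (i, l) * B $$ (l, j))"
  using assms by (auto simp: scalar_prod_def lessThan_atLeast0 intro!: sum.cong)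

text \<open>With one common dimension \<open>n\<close> the premises contain no inner dimension that
  is absent from the conclusion, so the simplifier can discharge carrier conditions of long
  products.\<close>

lemma mult_square_carrier [simp]:
  "A \<in> carrier_mat n n \<Longrightarrow> B \<in> carrier_mat n n \<Longrightarrow> A * B \<in> carrier_mat n n"
  by (rule mult_carrier_mat)

lemma assoc_mult_square:
  fixes A B C :: "'a :: semiring_0 mat"
  assumes "A \<in> carrier_mat n n" and "B \<in> carrier_mat n n" and "C \<in> carrier_mat n n"
  shows "A * B * C = A * (B * C)"
  using assms by (rule assoc_mult_mat)

lemma mat_adjoint_mult:
  fixes A B :: "complex mat"
  assumes "A \<in> carrier_mat a b" and "B \<in> carrier_mat b c"
  shows "mat_adjoint (A * B) = mat_adjoint B * mat_adjoint A"
proof (rule eq_matI)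
  fix i j assume "i < dim_row (mat_adjoint B * mat_adjoint A)" and "j < dim_col (mat_adjoint B * mat_adjoint A)"
  then have ij: "i < c" "j < a" using assms by auto
  show "mat_adjoint (A * B) $$ (i, j) = (mat_adjoint B * mat_adjoint A) $$ (i, j)"
    using assms ij
    by (simp add: index_mat_adjoint index_mult_mat_sum[of A a b B c]
        index_mult_mat_sum[of "mat_adjoint B" c b "mat_adjoint A" a] mult.commute del: index_mult_mat(1))
qed (use assms in auto)

lemma index_mult_mult_adjoint:
  fixes A X B :: "complex mat"
  assumes "A \<in> carrier_mat a n" and "X \<in> carrier_mat n n" and "B \<in> carrier_mat b n"
    and "i < a" and "j < b"
  shows "(A * X * mat_adjoint B) $$ (i, j) =
    (\<Sum>r<n. \<Sum>s<n. A $$ (i, r) * X $$ (r, s) * cnj (B $$ (j, s)))"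
proof -
  have "(A * X * mat_adjoint B) $$ (i, j) =
      (\<Sum>s<n. (\<Sum>r<n. A $$ (i, r) * X $$ (r, s)) * cnj (B $$ (j, s)))"
    using assms by (simp add: index_mult_mat_sum[of "A * X" a n _ b] index_mult_mat_sum[of A a n X n]
        index_mat_adjoint del: index_mult_mat(1))
  also have "\<dots> = (\<Sum>r<n. \<Sum>s<n. A $$ (i, r) * X $$ (r, s) * cnj (B $$ (j, s)))"
    unfolding sum_distrib_right by (rule sum.swap)
  finally show ?thesis .
qed

section \<open>Quadratic forms and positive semidefinite matrices\<close>

lemma quadratic_form_sum:
  fixes X :: "complex mat"
  assumes "X \<in> carrier_mat n n" and "x \<in> carrier_vec n"
  shows "(X *\<^sub>v x) \<bullet>c x = (\<Sum>i<n. \<Sum>j<n. X $$ (i, j) * x $ j * cnj (x $ i))"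
  using assms by (auto simp: scalar_prod_def lessThan_atLeast0 conjugate_complex_def sum_distrib_right
      intro!: sum.cong)

lemma cscalar_prod_mult_adjoint:
  fixes A :: "complex mat"
  assumes "A \<in> carrier_mat n m" and "y \<in> carrier_vec m" and "x \<in> carrier_vec n"
  shows "(A *\<^sub>v y) \<bullet>c x = y \<bullet>c (mat_adjoint A *\<^sub>v x)"
proof -
  have "(A *\<^sub>v y) \<bullet>c x = (\<Sum>i<n. \<Sum>j<m. A $$ (i, j) * y $ j * cnj (x $ i))"
    using assms by (auto simp: scalar_prod_def lessThan_atLeast0 conjugate_complex_def sum_distrib_right
      intro!: sum.cong)
  also have "\<dots> = (\<Sum>j<m. \<Sum>i<n. A $$ (i, j) * y $ j * cnj (x $ i))"
    by (rule sum.swap)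
  also have "\<dots> = y \<bullet>c (mat_adjoint A *\<^sub>v x)"
    using assms by (auto simp: scalar_prod_def lessThan_atLeast0 conjugate_complex_def sum_distrib_left
      index_mat_adjoint intro!: sum.cong)
  finally show ?thesis .
qed

text \<open>The quadratic form of \<open>A * X * mat_adjoint A\<close> at \<open>x\<close> is that
  of \<open>X\<close> at \<open>mat_adjoint A *\<^sub>v x\<close>.\<close>

lemma pos_semidef_mat_conj:
  assumes X: "pos_semidef_mat n X" and A: "A \<in> carrier_mat m n"
  shows "pos_semidef_mat m (A * X * mat_adjoint A)"
proof -
  have Xc: "X \<in> carrier_mat n n" and Xh: "mat_adjoint X = X"
    and Xp: "\<And>x. x \<in> carrier_vec n \<Longrightarrow> 0 \<le> (X *\<^sub>v x) \<bullet>c x"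
    using X unfolding pos_semidef_mat_def by auto
  have AX: "A * X \<in> carrier_mat m n" using A Xc by auto
  have "mat_adjoint (A * X * mat_adjoint A) = A * X * mat_adjoint A"
    using mat_adjoint_mult[OF AX mat_adjoint_carrier[OF A]] mat_adjoint_mult[OF A Xc] A Xc Xh
    by (simp add: assoc_mult_mat[of A m n X n _ m])
  moreover have "0 \<le> (A * X * mat_adjoint A *\<^sub>v x) \<bullet>c x" if x: "x \<in> carrier_vec m" for x
  proof -
    have y: "mat_adjoint A *\<^sub>v x \<in> carrier_vec n" by (rule mult_mat_vec_carrier[OF mat_adjoint_carrier[OF A] x])
    have "A * X * mat_adjoint A *\<^sub>v x = A *\<^sub>v (X *\<^sub>v (mat_adjoint A *\<^sub>v x))"
      using A Xc x y AX by (simp add: assoc_mult_mat_vec[of _ m n _ m] assoc_mult_mat_vec[of _ m n _ n])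
    then show ?thesis
      using Xp[OF y] cscalar_prod_mult_adjoint[OF A _ x, of "X *\<^sub>v (mat_adjoint A *\<^sub>v x)"] Xc y by simp
  qed
  ultimately show ?thesis using A Xc unfolding pos_semidef_mat_def by auto
qed

text \<open>The quadratic form is additive in the matrix. The sum is formed entrywise so that the
  size \<open>n\<close> stays explicit, even when it is empty.\<close>

lemma pos_semidef_mat_sum:
  assumes Y: "\<And>t. t \<in> T \<Longrightarrow> pos_semidef_mat n (Y t)"
  shows "pos_semidef_mat n (mat n n (\<lambda>ij. \<Sum>t\<in>T. Y t $$ ij))" (is "pos_semidef_mat n ?S")
proof -
  have Yc: "Y t \<in> carrier_mat n n" and Yh: "mat_adjoint (Y t) = Y t"
    and Yp: "\<And>x. x \<in> carrier_vec n \<Longrightarrow> 0 \<le> (Y t *\<^sub>v x) \<bullet>c x" if "t \<in> T" for t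
    using Y[OF that] unfolding pos_semidef_mat_def by auto
  have herm: "cnj (Y t $$ (j, i)) = Y t $$ (i, j)" if "t \<in> T" "i < n" "j < n" for t i j
    using that by (metis Yc Yh carrier_matD index_mat_adjoint)
  have "mat_adjoint ?S = ?S"
    by (rule eq_matI) (auto simp: index_mat_adjoint herm intro!: sum.cong)
  moreover have "0 \<le> (?S *\<^sub>v x) \<bullet>c x" if x: "x \<in> carrier_vec n" for x
  proof -
    have "(?S *\<^sub>v x) \<bullet>c x = (\<Sum>i<n. \<Sum>j<n. \<Sum>t\<in>T. Y t $$ (i, j) * x $ j * cnj (x $ i))"
      using x by (simp add: quadratic_form_sum[of _ n] sum_distrib_right)
    also have "\<dots> = (\<Sum>t\<in>T. \<Sum>i<n. \<Sum>j<n. Y t $$ (i, j) * x $ j * cnj (x $ i))"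
      by (simp only: sum.swap[of _ "{..<n}" T])
    also have "\<dots> = (\<Sum>t\<in>T. (Y t *\<^sub>v x) \<bullet>c x)"
      using Yc x by (simp add: quadratic_form_sum[of _ n])
    finally show ?thesis using Yp x by (simp add: sum_nonneg)
  qed
  ultimately show ?thesis unfolding pos_semidef_mat_def by auto
qed

section \<open>Maps in Kraus form and their complete positivity\<close>

definition kraus_map ::
  "nat \<Rightarrow> 't set \<Rightarrow> ('t \<Rightarrow> complex mat) \<Rightarrow> complex mat \<Rightarrow> complex mat" where
  "kraus_map m T K X = mat m m (\<lambda>ij. \<Sum>t\<in>T. (K t * X * mat_adjoint (K t)) $$ ij)"

lemma linear_kraus_map:
  assumes K: "\<And>t. t \<in> T \<Longrightarrow> K t \<in> carrier_mat m n"
  shows "linear_mat_map n m (kraus_map m T K)"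
proof -
  have entry: "kraus_map m T K X $$ (a, b) =
      (\<Sum>t\<in>T. \<Sum>r<n. \<Sum>s<n. K t $$ (a, r) * X $$ (r, s) * cnj (K t $$ (b, s)))"
    if "X \<in> carrier_mat n n" "a < m" "b < m" for X a b
    using that by (simp add: kraus_map_def index_mult_mult_adjoint[OF K _ K] del: index_mult_mat(1))
  have dim: "dim_row (kraus_map m T K X) = m" "dim_col (kraus_map m T K X) = m" for X
    by (simp_all add: kraus_map_def)
  have "kraus_map m T K (X + Y) = kraus_map m T K X + kraus_map m T K Y"
    if X: "X \<in> carrier_mat n n" and Y: "Y \<in> carrier_mat n n" for X Y
  proof (rule eq_matI)
    fix a b assume "a < dim_row (kraus_map m T K X + kraus_map m T K Y)"
      and "b < dim_col (kraus_map m T K X + kraus_map m T K Y)"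
    then have ab: "a < m" "b < m" by (simp_all add: dim)
    show "kraus_map m T K (X + Y) $$ (a, b) = (kraus_map m T K X + kraus_map m T K Y) $$ (a, b)"
      using X Y ab by (simp add: dim entry distrib_left distrib_right sum.distrib)
  qed (simp_all add: dim)
  moreover have "kraus_map m T K (c \<cdot>\<^sub>m X) = c \<cdot>\<^sub>m kraus_map m T K X"
    if X: "X \<in> carrier_mat n n" for X c
  proof (rule eq_matI)
    fix a b assume "a < dim_row (c \<cdot>\<^sub>m kraus_map m T K X)" and "b < dim_col (c \<cdot>\<^sub>m kraus_map m T K X)"
    then have ab: "a < m" "b < m" by (simp_all add: dim)
    show "kraus_map m T K (c \<cdot>\<^sub>m X) $$ (a, b) = (c \<cdot>\<^sub>m kraus_map m T K X) $$ (a, b)"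
      using X ab by (simp add: dim entry sum_distrib_left mult_ac)
  qed (simp_all add: dim)
  ultimately show ?thesis unfolding linear_mat_map_def by (auto simp: kraus_map_def)
qed

text \<open>The indices \<open>c\<close> with \<open>c div n = i\<close> are exactly
  \<open>i * n + r\<close> with \<open>r < n\<close>. This restricts a sum over all indices of a
  block matrix to the \<open>i\<close>-th block.\<close>

lemma sum_if_div_eq:
  fixes f :: "nat \<Rightarrow> 'a :: comm_monoid_add"
  assumes "i < k"
  shows "(\<Sum>c<k * n. if i = c div n then f c else 0) = (\<Sum>r<n. f (i * n + r))"
proof -
  have "(\<Sum>c<k * n. if i = c div n then f c else 0) = sum f {c \<in> {..<k * n}. i = c div n}"
    by (rule sum.inter_filter[symmetric]) simp
  also have "{c \<in> {..<k * n}. i = c div n} = (\<lambda>r. i * n + r) ` {..<n}"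
  proof (intro equalityI subsetI)
    fix c assume "c \<in> {c \<in> {..<k * n}. i = c div n}"
    then have "c = i * n + c mod n" "c mod n < n"
      by (auto intro!: mod_less_divisor gr0I)
    then show "c \<in> (\<lambda>r. i * n + r) ` {..<n}" by blast
  next
    fix c assume "c \<in> (\<lambda>r. i * n + r) ` {..<n}"
    then obtain r where r: "r < n" "c = i * n + r" by auto
    have "i * n + r < Suc i * n" using r by simp
    also have "\<dots> \<le> k * n" using assms by (intro mult_le_mono1) simp
    finally show "c \<in> {c \<in> {..<k * n}. i = c div n}" using r by auto
  qed
  also have "sum f ((\<lambda>r. i * n + r) ` {..<n}) = (\<Sum>r<n. f (i * n + r))"
    by (subst sum.reindex) (auto simp: inj_on_def)
  finally show ?thesis .
qed

text \<open>The ampliation of a Kraus map is again of Kraus form, with each \<open>K t\<close>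
  replaced by its \<open>k\<close>-fold direct sum. Positivity then follows term by term from
  conjugation and summation.\<close>

lemma completely_positive_kraus_map:
  assumes K: "\<And>t. t \<in> T \<Longrightarrow> K t \<in> carrier_mat m n"
  shows "completely_positive n m (kraus_map m T K)"
  unfolding completely_positive_def
proof (intro allI impI)
  fix k X assume X: "pos_semidef_mat (k * n) X"
  then have Xc: "X \<in> carrier_mat (k * n) (k * n)" unfolding pos_semidef_mat_def by auto
  \<comment> \<open>This is the block diagonal matrix with \<open>k\<close> copies of
    \<open>K t\<close>, the tensor product of the identity of size \<open>k\<close> with
    \<open>K t\<close>.\<close>
  define A where "A t = mat (k * m) (k * n)
    (\<lambda>(a, c). if a div m = c div n then K t $$ (a mod m, c mod n) else 0)" for t
  have Ac: "A t \<in> carrier_mat (k * m) (k * n)" for t unfolding A_def by simp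
  have entry: "(A t * X * mat_adjoint (A t)) $$ (a, b) =
      (K t * mat_block n X (a div m) (b div m) * mat_adjoint (K t)) $$ (a mod m, b mod m)"
    if t: "t \<in> T" and a: "a < k * m" and b: "b < k * m" for t a b
  proof -
    have m: "0 < m" using a by (auto intro: gr0I)
    have ak: "a div m < k" and bk: "b div m < k"
      using a b by (auto simp: less_mult_imp_div_less)
    have "(A t * X * mat_adjoint (A t)) $$ (a, b) =
        (\<Sum>r<k * n. \<Sum>s<k * n. A t $$ (a, r) * X $$ (r, s) * cnj (A t $$ (b, s)))"
      by (rule index_mult_mult_adjoint[OF Ac Xc Ac a b])
    \<comment> \<open>Block diagonality confines \<open>r\<close> to block \<open>a div m\<close>
      and \<open>s\<close> to block \<open>b div m\<close>, so only one block of \<open>X\<close>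
      contributes.\<close>
    also have "\<dots> = (\<Sum>r<k * n. if a div m = r div n then
        (\<Sum>s<k * n. if b div m = s div n then
          K t $$ (a mod m, r mod n) * X $$ (r, s) * cnj (K t $$ (b mod m, s mod n)) else 0) else 0)"
      using a b by (auto simp: A_def intro!: sum.cong)
    also have "\<dots> = (\<Sum>r<n. \<Sum>s<n. K t $$ (a mod m, r) *
        X $$ (a div m * n + r, b div m * n + s) * cnj (K t $$ (b mod m, s)))"
      unfolding sum_if_div_eq[OF ak] sum_if_div_eq[OF bk] by (auto intro!: sum.cong)
    also have "\<dots> = (K t * mat_block n X (a div m) (b div m) * mat_adjoint (K t)) $$ (a mod m, b mod m)"
      using m by (subst index_mult_mult_adjoint[OF K[OF t] _ K[OF t]]) (auto simp: mat_block_def)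
    finally show ?thesis .
  qed
  have "ampliation k n m (kraus_map m T K) X =
      mat (k * m) (k * m) (\<lambda>ab. \<Sum>t\<in>T. (A t * X * mat_adjoint (A t)) $$ ab)"
  proof (rule eq_matI)
    fix a b
    assume "a < dim_row (mat (k * m) (k * m) (\<lambda>ab. \<Sum>t\<in>T. (A t * X * mat_adjoint (A t)) $$ ab))"
      and "b < dim_col (mat (k * m) (k * m) (\<lambda>ab. \<Sum>t\<in>T. (A t * X * mat_adjoint (A t)) $$ ab))"
    then have ab: "a < k * m" "b < k * m" by auto
    then have "0 < m" by (auto intro: gr0I)
    then show "ampliation k n m (kraus_map m T K) X $$ (a, b) =
      mat (k * m) (k * m) (\<lambda>ab. \<Sum>t\<in>T. (A t * X * mat_adjoint (A t)) $$ ab) $$ (a, b)"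
      using ab by (simp add: ampliation_def kraus_map_def entry del: index_mult_mat(1))
  qed (auto simp: ampliation_def)
  then show "pos_semidef_mat (k * m) (ampliation k n m (kraus_map m T K) X)"
    using pos_semidef_mat_sum[of T "k * m" "\<lambda>t. A t * X * mat_adjoint (A t)"]
      pos_semidef_mat_conj[OF X Ac] by simp
qed

section \<open>The trace inner product and unitary matrices\<close>

text \<open>This is the Hilbert-Schmidt inner product, conjugate-linear in the first argument. The
  entrywise form yields both trace expressions, of \<open>mat_adjoint A * B\<close> and of
  \<open>B * mat_adjoint A\<close>, by reordering the sums.\<close>

definition hs_inner :: "nat \<Rightarrow> complex mat \<Rightarrow> complex mat \<Rightarrow> complex" where
  "hs_inner n A B = (\<Sum>i<n. \<Sum>j<n. cnj (A $$ (i, j)) * B $$ (i, j))"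

lemma hs_inner_eq_trace:
  assumes "A \<in> carrier_mat n n" and "B \<in> carrier_mat n n"
  shows "hs_inner n A B = (\<Sum>j<n. (mat_adjoint A * B) $$ (j, j))"
proof -
  have "hs_inner n A B = (\<Sum>j<n. \<Sum>i<n. cnj (A $$ (i, j)) * B $$ (i, j))"
    unfolding hs_inner_def by (rule sum.swap)
  then show ?thesis
    using assms by (simp add: index_mult_mat_sum[of _ n n _ n] index_mat_adjoint del: index_mult_mat(1))
qed

lemma hs_inner_eq_trace':
  assumes "A \<in> carrier_mat n n" and "B \<in> carrier_mat n n"
  shows "hs_inner n A B = (\<Sum>i<n. (B * mat_adjoint A) $$ (i, i))"
  using assms by (simp add: hs_inner_def index_mult_mat_sum[of _ n n _ n] index_mat_adjoint
      mult.commute del: index_mult_mat(1))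

text \<open>In the trace of \<open>mat_adjoint A * B\<close> a common left factor \<open>U\<close>
  appears as \<open>mat_adjoint U * U\<close> in the middle and cancels.\<close>

lemma hs_inner_unitary_left:
  assumes U: "unitary_mat n U" and A: "A \<in> carrier_mat n n" and B: "B \<in> carrier_mat n n"
  shows "hs_inner n (U * A) (U * B) = hs_inner n A B"
proof -
  have Uc: "U \<in> carrier_mat n n" and UU: "mat_adjoint U * U = 1\<^sub>m n"
    using U unfolding unitary_mat_def by auto
  have "mat_adjoint (U * A) * (U * B) = mat_adjoint A * (mat_adjoint U * U) * B"
    using Uc A B by (simp add: mat_adjoint_mult[of U n n A n] assoc_mult_square[of _ n])
  also have "\<dots> = mat_adjoint A * B" using UU A by simp
  finally show ?thesis using Uc A B by (simp add: hs_inner_eq_trace)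
qed

text \<open>Here the other trace form is the right one: in \<open>B * mat_adjoint A\<close> a common
  right factor meets its adjoint in the middle.\<close>

lemma hs_inner_unitary_right:
  assumes U: "unitary_mat n U" and A: "A \<in> carrier_mat n n" and B: "B \<in> carrier_mat n n"
  shows "hs_inner n (A * U) (B * U) = hs_inner n A B"
proof -
  have Uc: "U \<in> carrier_mat n n" and UU: "U * mat_adjoint U = 1\<^sub>m n"
    using U unfolding unitary_mat_def by auto
  have "B * U * mat_adjoint (A * U) = B * (U * mat_adjoint U) * mat_adjoint A"
    using Uc A B by (simp add: mat_adjoint_mult[of A n n U n] assoc_mult_square[of _ n])
  also have "\<dots> = B * mat_adjoint A" using UU B by simp
  finally show ?thesis using Uc A B by (simp add: hs_inner_eq_trace')
qed

lemma hs_inner_smult: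
  assumes "A \<in> carrier_mat n n" and "B \<in> carrier_mat n n"
  shows "hs_inner n (a \<cdot>\<^sub>m A) (b \<cdot>\<^sub>m B) = cnj a * b * hs_inner n A B"
  using assms by (simp add: hs_inner_def sum_distrib_left algebra_simps)

lemma hs_inner_unitary_self:
  assumes "unitary_mat n U"
  shows "hs_inner n U U = of_nat n"
  using assms by (simp add: hs_inner_eq_trace unitary_mat_def)

lemma unitary_mat_one: "unitary_mat n (1\<^sub>m n)"
proof -
  have "mat_adjoint (1\<^sub>m n) = (1\<^sub>m n :: complex mat)"
    by (rule eq_matI) (auto simp: index_mat_adjoint)
  then show ?thesis unfolding unitary_mat_def by simp
qed

lemma unitary_mat_mult:
  assumes U: "unitary_mat n U" and V: "unitary_mat n V"
  shows "unitary_mat n (U * V)"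
proof -
  have c: "U \<in> carrier_mat n n" "V \<in> carrier_mat n n"
    and U1: "mat_adjoint U * U = 1\<^sub>m n" "U * mat_adjoint U = 1\<^sub>m n"
    and V1: "mat_adjoint V * V = 1\<^sub>m n" "V * mat_adjoint V = 1\<^sub>m n"
    using U V unfolding unitary_mat_def by auto
  have "mat_adjoint (U * V) * (U * V) = mat_adjoint V * (mat_adjoint U * U) * V"
    and "U * V * mat_adjoint (U * V) = U * (V * mat_adjoint V) * mat_adjoint U"
    using c by (simp_all add: mat_adjoint_mult[of U n n V n] assoc_mult_square[of _ n])
  then show ?thesis using c U1 V1 unfolding unitary_mat_def by simp
qed

lemma unitary_mat_pow: "unitary_mat n U \<Longrightarrow> unitary_mat n (U ^\<^sub>m k)"
proof (induction k)
  case 0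
  then show ?case using unitary_mat_one[of n] by (auto simp: unitary_mat_def)
qed (simp add: unitary_mat_mult)

section \<open>A unital completely positive map built from an orthogonal family\<close>

text \<open>If \<open>x\<close> and \<open>x'\<close> move the two families in the same way,
  orthogonality of \<open>w\<close> leaves only the terms \<open>g = \<sigma> h\<close> in the image
  of \<open>x\<close>, and unitarity of each \<open>w' h\<close> turns each of them into a multiple
  of \<open>x'\<close>. The map depends only on the families, so it is chosen before
  \<open>x\<close>, \<open>x'\<close>, \<open>c\<close> and \<open>\<sigma>\<close>; thus a single
  map serves both generators.\<close>

lemma ex_ucp_map_of_orthogonal_family:
  fixes w w' :: "'g \<Rightarrow> complex mat"
  assumes G: "finite G" "G \<noteq> {}" and d: "0 < d"
    and w: "\<And>g. g \<in> G \<Longrightarrow> w g \<in> carrier_mat d d"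
    and w': "\<And>g. g \<in> G \<Longrightarrow> unitary_mat d' (w' g)"
    and orth: "\<And>g h. g \<in> G \<Longrightarrow> h \<in> G \<Longrightarrow> hs_inner d (w g) (w h) = (if g = h then of_nat d else 0)"
  shows "\<exists>\<Phi>. ucp_map d d' \<Phi> \<and> (\<forall>x x' c \<sigma>. x \<in> carrier_mat d d \<longrightarrow> x' \<in> carrier_mat d' d' \<longrightarrow>
    (\<forall>h\<in>G. \<sigma> h \<in> G \<and> x * w h = c h \<cdot>\<^sub>m w (\<sigma> h) \<and> x' * w' h = c h \<cdot>\<^sub>m w' (\<sigma> h)) \<longrightarrow> \<Phi> x = x')"
proof -
  \<comment> \<open>The operators \<open>\<kappa> \<Sum>\<^sub>g w'\<^sub>g E\<^sub>r\<^sub>s w\<^sub>g\<^sup>*\<close>, with \<open>E\<^sub>r\<^sub>s\<close> a matrix unit, are Kraus operators of \<open>\<Phi>\<close>.\<close>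
  define \<kappa> where "\<kappa> = complex_of_real (1 / sqrt (real d * real (card G)))"
  define T where "T = {..<d'} \<times> {..<d}"
  define K where "K = (\<lambda>(r, s). mat d' d (\<lambda>(a, i). \<kappa> * (\<Sum>g\<in>G. w' g $$ (a, r) * cnj (w g $$ (i, s)))))"
  have card: "0 < card G" using G by (simp add: card_gt_0_iff)
  \<comment> \<open>The factor \<open>\<kappa>\<close> enters once through \<open>K\<close> and once
    through its adjoint, hence the square root. The product cancels \<open>d\<close>, the squared
    norm of each \<open>w g\<close>, and \<open>card G\<close>, the number of terms that
    survive.\<close>
  have \<kappa>_sq: "\<kappa> * cnj \<kappa> * (of_nat d * of_nat (card G)) = 1"
  proof -
    have "\<kappa> * cnj \<kappa> = complex_of_real (1 / (real d * real (card G)))"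
      unfolding \<kappa>_def complex_cnj_complex_of_real of_real_mult[symmetric] by simp
    then show ?thesis using d card by simp
  qed
  have K: "K t \<in> carrier_mat d' d" for t unfolding K_def by (cases t) simp
  have w'c: "w' g \<in> carrier_mat d' d'" if "g \<in> G" for g using w'[OF that] unfolding unitary_mat_def by simp
  have eq: "kraus_map d' T K x = x'"
    if x: "x \<in> carrier_mat d d" and x': "x' \<in> carrier_mat d' d'"
      and \<sigma>: "\<And>h. h \<in> G \<Longrightarrow> \<sigma> h \<in> G"
      and xw: "\<And>h. h \<in> G \<Longrightarrow> x * w h = c h \<cdot>\<^sub>m w (\<sigma> h)"
      and xw': "\<And>h. h \<in> G \<Longrightarrow> x' * w' h = c h \<cdot>\<^sub>m w' (\<sigma> h)" for x x' c \<sigma>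
  proof (rule eq_matI)
    fix a b assume "a < dim_row x'" and "b < dim_col x'"
    then have a: "a < d'" and b: "b < d'" using x' by auto
    \<comment> \<open>Conjugating the entries of \<open>K\<close> brings out the columns of
      \<open>w h\<close>, so \<open>x\<close> meets the family only through \<open>x * w h\<close>,
      which \<open>xw\<close> evaluates.\<close>
    have xK: "(\<Sum>j<d. x $$ (i, j) * cnj (K (r, s) $$ (b, j))) =
        cnj \<kappa> * (\<Sum>h\<in>G. cnj (w' h $$ (b, r)) * c h * w (\<sigma> h) $$ (i, s))"
      if r: "r < d'" and s: "s < d" and i: "i < d" for r s i
    proof -
      have "(\<Sum>j<d. x $$ (i, j) * cnj (K (r, s) $$ (b, j))) =
          (\<Sum>j<d. \<Sum>h\<in>G. cnj \<kappa> * cnj (w' h $$ (b, r)) * (x $$ (i, j) * w h $$ (j, s)))"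
        using b by (simp add: K_def sum_distrib_left algebra_simps)
      also have "\<dots> = (\<Sum>h\<in>G. cnj \<kappa> * cnj (w' h $$ (b, r)) * (x * w h) $$ (i, s))"
        using x w i s by (subst sum.swap) (simp add: sum_distrib_left index_mult_mat_sum[of x d d _ d]
            del: index_mult_mat(1))
      also have "\<dots> = (\<Sum>h\<in>G. cnj \<kappa> * cnj (w' h $$ (b, r)) * (c h * w (\<sigma> h) $$ (i, s)))"
        using carrier_matD[OF w[OF \<sigma>]] i s by (intro sum.cong) (simp_all add: xw del: index_mult_mat(1))
      finally show ?thesis by (simp add: sum_distrib_left mult.assoc)
    qed
    have "kraus_map d' T K x $$ (a, b) = (\<Sum>r<d'. \<Sum>s<d. (K (r, s) * x * mat_adjoint (K (r, s))) $$ (a, b))"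
      using a b unfolding kraus_map_def T_def sum.cartesian_product by (simp add: case_prod_unfold)
    also have "\<dots> = (\<Sum>r<d'. \<Sum>s<d. \<Sum>i<d. K (r, s) $$ (a, i) * (\<Sum>j<d. x $$ (i, j) * cnj (K (r, s) $$ (b, j))))"
      using a b by (simp add: index_mult_mult_adjoint[OF K x K] sum_distrib_left mult.assoc del: index_mult_mat(1))
    also have "\<dots> = (\<Sum>r<d'. \<Sum>s<d. \<Sum>i<d. \<Sum>h\<in>G. \<Sum>g\<in>G. \<kappa> * cnj \<kappa> *
        (w' g $$ (a, r) * cnj (w' h $$ (b, r)) * c h) * (cnj (w g $$ (i, s)) * w (\<sigma> h) $$ (i, s)))"
    proof (intro sum.cong refl)
      fix r s i assume "r \<in> {..<d'}" "s \<in> {..<d}" "i \<in> {..<d}"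
      then have rsi: "r < d'" "s < d" "i < d" by auto
      have "K (r, s) $$ (a, i) * (\<Sum>j<d. x $$ (i, j) * cnj (K (r, s) $$ (b, j))) =
          \<kappa> * cnj \<kappa> * ((\<Sum>h\<in>G. cnj (w' h $$ (b, r)) * c h * w (\<sigma> h) $$ (i, s)) *
            (\<Sum>g\<in>G. w' g $$ (a, r) * cnj (w g $$ (i, s))))"
        unfolding xK[OF rsi] using a rsi by (simp add: K_def)
      also have "\<dots> = (\<Sum>h\<in>G. \<Sum>g\<in>G. \<kappa> * cnj \<kappa> *
          (w' g $$ (a, r) * cnj (w' h $$ (b, r)) * c h) * (cnj (w g $$ (i, s)) * w (\<sigma> h) $$ (i, s)))"
        unfolding sum_product unfolding sum_distrib_left by (intro sum.cong refl) (simp only: mult_ac)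
      finally show "K (r, s) $$ (a, i) * (\<Sum>j<d. x $$ (i, j) * cnj (K (r, s) $$ (b, j))) = \<dots>" .
    qed
    \<comment> \<open>Summing over all matrix units, that is over \<open>s\<close> together with the
      inner index \<open>i\<close>, assembles the trace inner product of \<open>w g\<close> and
      \<open>w (\<sigma> h)\<close>.\<close>
    also have "\<dots> = (\<Sum>r<d'. \<Sum>h\<in>G. \<Sum>g\<in>G. \<kappa> * cnj \<kappa> *
        (w' g $$ (a, r) * cnj (w' h $$ (b, r)) * c h) * hs_inner d (w g) (w (\<sigma> h)))"
      unfolding hs_inner_def sum_distrib_left sum.swap[of _ G "{..<d}"]
      by (rule sum.cong[OF refl], rule sum.cong[OF refl], rule sum.cong[OF refl], rule sum.swap)
    \<comment> \<open>Orthogonality collapses the sum over \<open>g\<close> to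
      \<open>g = \<sigma> h\<close>, which lies in \<open>G\<close>.\<close>
    also have "\<dots> = (\<Sum>r<d'. \<Sum>h\<in>G. \<kappa> * cnj \<kappa> *
        (w' (\<sigma> h) $$ (a, r) * cnj (w' h $$ (b, r)) * c h) * of_nat d)"
      using \<sigma> G by (simp add: orth if_distrib sum.delta' cong: if_cong)
    also have "\<dots> = (\<Sum>h\<in>G. \<kappa> * cnj \<kappa> * of_nat d *
        (\<Sum>r<d'. (c h \<cdot>\<^sub>m w' (\<sigma> h)) $$ (a, r) * cnj (w' h $$ (b, r))))"
      using carrier_matD[OF w'c[OF \<sigma>]] a by (subst sum.swap) (auto simp: sum_distrib_left mult_ac intro!: sum.cong)
    \<comment> \<open>Read backwards, \<open>xw'\<close> recovers \<open>x' * w' h\<close>, and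
      unitarity of \<open>w' h\<close> removes the family; the summand no longer depends on
      \<open>h\<close>.\<close>
    also have "\<dots> = (\<Sum>h\<in>G. \<kappa> * cnj \<kappa> * of_nat d * x' $$ (a, b))"
    proof (rule sum.cong[OF refl])
      fix h assume h: "h \<in> G"
      have U: "w' h * mat_adjoint (w' h) = 1\<^sub>m d'" using w'[OF h] unfolding unitary_mat_def by simp
      have "(\<Sum>r<d'. (c h \<cdot>\<^sub>m w' (\<sigma> h)) $$ (a, r) * cnj (w' h $$ (b, r))) =
          (x' * w' h * mat_adjoint (w' h)) $$ (a, b)"
        using w'c[OF h] w'c[OF \<sigma>[OF h]] a b x' unfolding xw'[OF h]
        by (simp add: index_mult_mat_sum[of _ d' d' _ d'] index_mat_adjoint del: index_mult_mat(1))
      also have "x' * w' h * mat_adjoint (w' h) = x'"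
        using w'c[OF h] x' U by (simp add: assoc_mult_square[of _ d'])
      finally show "\<kappa> * cnj \<kappa> * of_nat d * (\<Sum>r<d'. (c h \<cdot>\<^sub>m w' (\<sigma> h)) $$ (a, r) * cnj (w' h $$ (b, r))) =
          \<kappa> * cnj \<kappa> * of_nat d * x' $$ (a, b)" by simp
    qed
    also have "\<dots> = (\<kappa> * cnj \<kappa> * (of_nat d * of_nat (card G))) * x' $$ (a, b)"
      by (simp add: mult_ac)
    finally show "kraus_map d' T K x $$ (a, b) = x' $$ (a, b)" unfolding \<kappa>_sq by simp
  qed (use x' in \<open>auto simp: kraus_map_def\<close>)
  \<comment> \<open>Unitality is the instance of \<open>eq\<close> in which the identity matrices
    fix every member of both families.\<close>
  have "kraus_map d' T K (1\<^sub>m d) = 1\<^sub>m d'"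
  proof (rule eq[of _ _ id "\<lambda>_. 1"])
    fix h assume h: "h \<in> G"
    show "1\<^sub>m d * w h = 1 \<cdot>\<^sub>m w (id h)" using w[OF h] by (intro eq_matI) auto
    show "1\<^sub>m d' * w' h = 1 \<cdot>\<^sub>m w' (id h)" using w'c[OF h] by (intro eq_matI) auto
  qed auto
  then have "ucp_map d d' (kraus_map d' T K)"
    unfolding ucp_map_def using linear_kraus_map[of T K d' d] completely_positive_kraus_map[of T K d' d] K by auto
  with eq show ?thesis by blast
qed

section \<open>Matrix powers and the Weyl commutation relation\<close>

text \<open>Powers unfold with the new factor on the right, while the monomials are multiplied from
  the left.\<close>

lemma pow_mat_Suc_left:
  fixes A :: "complex mat"
  assumes A: "A \<in> carrier_mat n n"
  shows "A ^\<^sub>m Suc k = A * A ^\<^sub>m k"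
proof (induction k)
  case (Suc k)
  have "A ^\<^sub>m Suc (Suc k) = A * A ^\<^sub>m k * A" using Suc by simp
  also have "\<dots> = A * A ^\<^sub>m Suc k" using A by (simp add: assoc_mult_square[of _ n])
  finally show ?case .
qed (use A in simp)

text \<open>Only \<open>Suc k = p\<close> is a genuine case: the exponent wraps around to
  \<open>0\<close>, and both powers are the identity.\<close>

lemma pow_mat_Suc_mod:
  fixes A :: "complex mat"
  assumes "A \<in> carrier_mat n n" and "A ^\<^sub>m p = 1\<^sub>m n" and "k < p"
  shows "A ^\<^sub>m Suc k = A ^\<^sub>m (Suc k mod p)"
  using assms by (cases "Suc k = p") (auto simp del: pow_mat.simps(2))

lemma smult_mat_smult_mat:
  fixes A :: "'a :: semigroup_mult mat"
  shows "a \<cdot>\<^sub>m (b \<cdot>\<^sub>m A) = (a * b) \<cdot>\<^sub>m A"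
  by (rule eq_matI) (auto simp: mult.assoc)

text \<open>Each of the \<open>k\<close> factors \<open>v\<close> that \<open>u\<close> passes
  contributes one factor \<open>\<zeta>\<close>.\<close>

lemma weyl_pair_pow_right:
  assumes c: "u \<in> carrier_mat n n" "v \<in> carrier_mat n n" and uv: "u * v = \<zeta> \<cdot>\<^sub>m (v * u)"
  shows "u * v ^\<^sub>m k = (\<zeta> ^ k :: complex) \<cdot>\<^sub>m (v ^\<^sub>m k * u)"
proof (induction k)
  case 0
  then show ?case using c by (intro eq_matI) auto
next
  case (Suc k)
  have vk: "v ^\<^sub>m k \<in> carrier_mat n n" using c by simp
  have "u * v ^\<^sub>m Suc k = (u * v ^\<^sub>m k) * v" using c by (simp add: assoc_mult_square[of _ n])
  also have "\<dots> = \<zeta> ^ k \<cdot>\<^sub>m (v ^\<^sub>m k * (u * v))"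
    unfolding Suc using c vk by (simp add: mult_smult_assoc_mat[of _ n n _ n] assoc_mult_square[of _ n])
  also have "\<dots> = \<zeta> ^ Suc k \<cdot>\<^sub>m (v ^\<^sub>m Suc k * u)"
    unfolding uv using c vk
    by (simp add: mult_smult_distrib[of _ n n _ n] assoc_mult_square[of _ n] smult_mat_smult_mat mult.commute)
  finally show ?case .
qed

lemma weyl_pair_pow_left:
  assumes c: "u \<in> carrier_mat n n" "v \<in> carrier_mat n n" and uv: "u * v = \<zeta> \<cdot>\<^sub>m (v * u)"
  shows "u ^\<^sub>m k * v = (\<zeta> ^ k :: complex) \<cdot>\<^sub>m (v * u ^\<^sub>m k)"
proof (induction k)
  case 0
  then show ?case using c by (intro eq_matI) auto
next
  case (Suc k)
  have uk: "u ^\<^sub>m k \<in> carrier_mat n n" using c by simp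
  have "u ^\<^sub>m Suc k * v = u ^\<^sub>m k * (u * v)" using c by (simp add: assoc_mult_square[of _ n])
  also have "\<dots> = \<zeta> \<cdot>\<^sub>m ((u ^\<^sub>m k * v) * u)"
    unfolding uv using c uk by (simp add: mult_smult_distrib[of _ n n _ n] assoc_mult_square[of _ n])
  also have "\<dots> = \<zeta> ^ Suc k \<cdot>\<^sub>m (v * u ^\<^sub>m Suc k)"
    unfolding Suc using c uk
    by (simp add: mult_smult_assoc_mat[of _ n n _ n] assoc_mult_square[of _ n] smult_mat_smult_mat mult.commute)
  finally show ?case .
qed

section \<open>Powers of a primitive root of unity\<close>

lemma primitive_root_of_unity_norm:
  assumes "primitive_root_of_unity p \<zeta>"
  shows "norm \<zeta> = 1"
proof -
  have "norm \<zeta> ^ p = 1" and "0 < p"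
    using assms unfolding primitive_root_of_unity_def by (metis norm_power norm_one, simp)
  then show ?thesis using power_eq_imp_eq_base[of "norm \<zeta>" p 1] by simp
qed

text \<open>Equal powers with \<open>i < j\<close> would give \<open>\<zeta> ^ (j - i) = 1\<close>
  with an exponent strictly between \<open>0\<close> and \<open>p\<close>.\<close>

lemma primitive_root_of_unity_inj:
  assumes \<zeta>: "primitive_root_of_unity p \<zeta>" and "i < p" and "j < p" and "\<zeta> ^ i = \<zeta> ^ j"
  shows "i = j"
proof -
  have \<zeta>0: "\<zeta> \<noteq> 0" using primitive_root_of_unity_norm[OF \<zeta>] by auto
  have False if "i < j" "j < p" "\<zeta> ^ i = \<zeta> ^ j" for i j
  proof -
    have "\<zeta> ^ j = \<zeta> ^ i * \<zeta> ^ (j - i)" using that(1) by (simp flip: power_add)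
    then have "\<zeta> ^ (j - i) = 1" using that \<zeta>0 by simp
    then show False using \<zeta> that unfolding primitive_root_of_unity_def
      by (metis diff_is_0_eq less_imp_diff_less not_le zero_less_diff)
  qed
  from this[of i j] this[of j i] show ?thesis using assms by (metis nat_neq_iff)
qed

text \<open>Since \<open>\<zeta>\<close> has modulus one, conjugation inverts its powers. The
  hypothesis has the form in which the scalars come out of the sesquilinear
  \<open>hs_inner\<close>.\<close>

lemma primitive_root_of_unity_cnj_power:
  assumes \<zeta>: "primitive_root_of_unity p \<zeta>" and "i < p" and "j < p" and "cnj (\<zeta> ^ i) * \<zeta> ^ j = 1"
  shows "i = j"
proof -
  have "\<zeta> ^ i * cnj (\<zeta> ^ i) = 1"
    using primitive_root_of_unity_norm[OF \<zeta>] complex_norm_square[of "\<zeta> ^ i"] by (simp add: norm_power)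
  then have "\<zeta> ^ j = \<zeta> ^ i * cnj (\<zeta> ^ i) * \<zeta> ^ j" by (simp only: mult_1_left)
  also have "\<dots> = \<zeta> ^ i" using assms(4) by (simp only: mult.assoc mult_1_right)
  finally have "\<zeta> ^ i = \<zeta> ^ j" by (rule sym)
  then show ?thesis using primitive_root_of_unity_inj[OF \<zeta>] assms by blast
qed

section \<open>Orthogonality and shifts of the Weyl monomials, and universality\<close>

text \<open>Conjugation by a unitary preserves the inner product, yet conjugation by
  \<open>u\<close> multiplies it by \<open>cnj (\<zeta> ^ i) * \<zeta> ^ k\<close>. So it vanishes
  unless \<open>i = k\<close>; conjugation by \<open>v\<close> separates \<open>j\<close> from
  \<open>l\<close> in the same way.\<close>

lemma hs_inner_weyl_monomials:
  assumes \<zeta>: "primitive_root_of_unity p \<zeta>" and uv: "weyl_pair p \<zeta> n u v"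
    and lt: "i < p" "j < p" "k < p" "l < p"
  shows "hs_inner n (v ^\<^sub>m i * u ^\<^sub>m j) (v ^\<^sub>m k * u ^\<^sub>m l) = (if i = k \<and> j = l then of_nat n else 0)"
proof -
  have U: "unitary_mat n u" "unitary_mat n v" and rel: "u * v = \<zeta> \<cdot>\<^sub>m (v * u)"
    using uv unfolding weyl_pair_def by auto
  then have c: "u \<in> carrier_mat n n" "v \<in> carrier_mat n n" unfolding unitary_mat_def by auto
  define w where "w i j = v ^\<^sub>m i * u ^\<^sub>m j" for i j
  have wU: "unitary_mat n (w i j)" for i j unfolding w_def by (intro unitary_mat_mult unitary_mat_pow U)
  then have wc: "w i j \<in> carrier_mat n n" for i j unfolding unitary_mat_def by auto
  \<comment> \<open>This says that \<open>w i j\<close> is an eigenvector of conjugation by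
    \<open>u\<close>, written without inverses; \<open>wv\<close> is the analogue for
    \<open>v\<close>.\<close>
  have uw: "u * w i j = \<zeta> ^ i \<cdot>\<^sub>m (w i j * u)" for i j
  proof -
    have "u * w i j = (u * v ^\<^sub>m i) * u ^\<^sub>m j" unfolding w_def using c by (simp add: assoc_mult_square[of _ n])
    also have "\<dots> = \<zeta> ^ i \<cdot>\<^sub>m (v ^\<^sub>m i * (u * u ^\<^sub>m j))"
      unfolding weyl_pair_pow_right[OF c rel] using c
      by (simp add: mult_smult_assoc_mat[of _ n n _ n] assoc_mult_square[of _ n])
    also have "\<dots> = \<zeta> ^ i \<cdot>\<^sub>m (w i j * u)"
      unfolding w_def pow_mat_Suc_left[OF c(1), symmetric] using c by (simp add: assoc_mult_square[of _ n])
    finally show ?thesis .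
  qed
  have wv: "w i j * v = \<zeta> ^ j \<cdot>\<^sub>m (v * w i j)" for i j
  proof -
    have "w i j * v = v ^\<^sub>m i * (u ^\<^sub>m j * v)" unfolding w_def using c by (simp add: assoc_mult_square[of _ n])
    also have "\<dots> = \<zeta> ^ j \<cdot>\<^sub>m ((v ^\<^sub>m i * v) * u ^\<^sub>m j)"
      unfolding weyl_pair_pow_left[OF c rel] using c
      by (simp add: mult_smult_distrib[of _ n n _ n] assoc_mult_square[of _ n])
    also have "v ^\<^sub>m i * v = v * v ^\<^sub>m i" using pow_mat_Suc_left[OF c(2)] by simp
    finally show ?thesis unfolding w_def using c by (simp add: assoc_mult_square[of _ n])
  qed
  have "hs_inner n (w i j) (w k l) = hs_inner n (u * w i j) (u * w k l)"
    using hs_inner_unitary_left[OF U(1) wc wc] by simp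
  also have "\<dots> = cnj (\<zeta> ^ i) * \<zeta> ^ k * hs_inner n (w i j * u) (w k l * u)"
    unfolding uw by (rule hs_inner_smult) (use wc c in auto)
  also have "\<dots> = cnj (\<zeta> ^ i) * \<zeta> ^ k * hs_inner n (w i j) (w k l)"
    using hs_inner_unitary_right[OF U(1) wc wc] by simp
  finally have 1: "cnj (\<zeta> ^ i) * \<zeta> ^ k = 1 \<or> hs_inner n (w i j) (w k l) = 0" by auto
  have "hs_inner n (w i j) (w k l) = hs_inner n (w i j * v) (w k l * v)"
    using hs_inner_unitary_right[OF U(2) wc wc] by simp
  also have "\<dots> = cnj (\<zeta> ^ j) * \<zeta> ^ l * hs_inner n (v * w i j) (v * w k l)"
    unfolding wv by (rule hs_inner_smult) (use wc c in auto)
  also have "\<dots> = cnj (\<zeta> ^ j) * \<zeta> ^ l * hs_inner n (w i j) (w k l)"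
    using hs_inner_unitary_left[OF U(2) wc wc] by simp
  finally have 2: "cnj (\<zeta> ^ j) * \<zeta> ^ l = 1 \<or> hs_inner n (w i j) (w k l) = 0" by auto
  have "hs_inner n (w i j) (w k l) = (if i = k \<and> j = l then of_nat n else 0)"
    using 1 2 primitive_root_of_unity_cnj_power[OF \<zeta>] lt hs_inner_unitary_self[OF wU] by auto
  then show ?thesis unfolding w_def .
qed

text \<open>The scalars and the new exponents depend only on \<open>p\<close>,
  \<open>\<zeta>\<close>, \<open>k\<close> and \<open>l\<close>, hence agree for any two Weyl pairs.
  The factor \<open>1\<close> in the second equation gives it the shape
  \<open>c h \<cdot>\<^sub>m w (\<sigma> h)\<close>.\<close>

lemma weyl_monomial_shift:
  assumes uv: "weyl_pair p \<zeta> n u v" and "k < p" and "l < p"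
  shows "u * (v ^\<^sub>m k * u ^\<^sub>m l) = \<zeta> ^ k \<cdot>\<^sub>m (v ^\<^sub>m k * u ^\<^sub>m (Suc l mod p))"
    and "v * (v ^\<^sub>m k * u ^\<^sub>m l) = 1 \<cdot>\<^sub>m (v ^\<^sub>m (Suc k mod p) * u ^\<^sub>m l)"
proof -
  have c: "u \<in> carrier_mat n n" "v \<in> carrier_mat n n" and p: "u ^\<^sub>m p = 1\<^sub>m n" "v ^\<^sub>m p = 1\<^sub>m n"
    and rel: "u * v = \<zeta> \<cdot>\<^sub>m (v * u)"
    using uv unfolding weyl_pair_def unitary_mat_def by auto
  have "u * (v ^\<^sub>m k * u ^\<^sub>m l) = (u * v ^\<^sub>m k) * u ^\<^sub>m l" using c by (simp add: assoc_mult_square[of _ n])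
  also have "\<dots> = \<zeta> ^ k \<cdot>\<^sub>m (v ^\<^sub>m k * (u * u ^\<^sub>m l))"
    unfolding weyl_pair_pow_right[OF c rel] using c
    by (simp add: mult_smult_assoc_mat[of _ n n _ n] assoc_mult_square[of _ n])
  also have "u * u ^\<^sub>m l = u ^\<^sub>m (Suc l mod p)"
    using pow_mat_Suc_left[OF c(1)] pow_mat_Suc_mod[OF c(1) p(1)] assms by metis
  finally show "u * (v ^\<^sub>m k * u ^\<^sub>m l) = \<zeta> ^ k \<cdot>\<^sub>m (v ^\<^sub>m k * u ^\<^sub>m (Suc l mod p))" .
  have "v * (v ^\<^sub>m k * u ^\<^sub>m l) = (v * v ^\<^sub>m k) * u ^\<^sub>m l" using c by (simp add: assoc_mult_square[of _ n])
  also have "v * v ^\<^sub>m k = v ^\<^sub>m (Suc k mod p)"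
    using pow_mat_Suc_left[OF c(2)] pow_mat_Suc_mod[OF c(2) p(2)] assms by metis
  also have "\<dots> * u ^\<^sub>m l = 1 \<cdot>\<^sub>m (\<dots> * u ^\<^sub>m l)" by (intro eq_matI) auto
  finally show "v * (v ^\<^sub>m k * u ^\<^sub>m l) = 1 \<cdot>\<^sub>m (v ^\<^sub>m (Suc k mod p) * u ^\<^sub>m l)" .
qed

theorem corollary2p9:
  fixes p d :: nat and \<zeta> :: complex and u v :: "complex mat"
  assumes "2 \<le> p"
    and "primitive_root_of_unity p \<zeta>"
    and "0 < d"
    and "weyl_pair p \<zeta> d u v"
  shows "universal_for_weyl_pairs p \<zeta> d u v"
  unfolding universal_for_weyl_pairs_def
proof (intro allI impI)
  fix d' u' v' assume uv': "weyl_pair p \<zeta> d' u' v'"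
  note \<zeta> = assms(2) and uv = assms(4)
  have U: "unitary_mat d u" "unitary_mat d v" "unitary_mat d' u'" "unitary_mat d' v'"
    using uv uv' unfolding weyl_pair_def by auto
  then have c: "u \<in> carrier_mat d d" "v \<in> carrier_mat d d" "u' \<in> carrier_mat d' d'" "v' \<in> carrier_mat d' d'"
    unfolding unitary_mat_def by auto
  define G where "G = {..<p} \<times> {..<p}"
  define w where "w = (\<lambda>(k, l). v ^\<^sub>m k * u ^\<^sub>m l)"
  define w' where "w' = (\<lambda>(k, l). v' ^\<^sub>m k * u' ^\<^sub>m l)"
  have "\<exists>\<Phi>. ucp_map d d' \<Phi> \<and> (\<forall>x x' c \<sigma>. x \<in> carrier_mat d d \<longrightarrow> x' \<in> carrier_mat d' d' \<longrightarrow>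
    (\<forall>h\<in>G. \<sigma> h \<in> G \<and> x * w h = c h \<cdot>\<^sub>m w (\<sigma> h) \<and> x' * w' h = c h \<cdot>\<^sub>m w' (\<sigma> h)) \<longrightarrow> \<Phi> x = x')"
  proof (rule ex_ucp_map_of_orthogonal_family)
    show "finite G" "G \<noteq> {}" using assms(1) by (auto simp: G_def lessThan_empty_iff)
    show "w g \<in> carrier_mat d d" for g using c by (auto simp: w_def split: prod.split)
    show "unitary_mat d' (w' g)" for g
      using U by (auto simp: w'_def split: prod.split intro!: unitary_mat_mult unitary_mat_pow)
    show "hs_inner d (w g) (w h) = (if g = h then of_nat d else 0)" if "g \<in> G" "h \<in> G" for g h
      using that hs_inner_weyl_monomials[OF \<zeta> uv] by (auto simp: G_def w_def split: if_splits)
  qed fact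
  then obtain \<Phi> where \<Phi>: "ucp_map d d' \<Phi>"
    and eq: "\<And>x x' c \<sigma>. x \<in> carrier_mat d d \<Longrightarrow> x' \<in> carrier_mat d' d' \<Longrightarrow>
      (\<forall>h\<in>G. \<sigma> h \<in> G \<and> x * w h = c h \<cdot>\<^sub>m w (\<sigma> h) \<and> x' * w' h = c h \<cdot>\<^sub>m w' (\<sigma> h)) \<Longrightarrow> \<Phi> x = x'"
    by blast
  \<comment> \<open>Multiplication by \<open>u\<close> shifts the exponent of \<open>u\<close>
    cyclically with weight \<open>\<zeta> ^ k\<close>; below, \<open>v\<close> shifts the exponent
    of \<open>v\<close> with weight \<open>1\<close>.\<close>
  have "\<Phi> u = u'"
    by (rule eq[of u u' "\<lambda>(k, l). (k, Suc l mod p)" "\<lambda>(k, l). \<zeta> ^ k"])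
      (use c in \<open>auto simp: G_def w_def w'_def weyl_monomial_shift[OF uv] weyl_monomial_shift[OF uv']\<close>)
  moreover have "\<Phi> v = v'"
    by (rule eq[of v v' "\<lambda>(k, l). (Suc k mod p, l)" "\<lambda>_. 1"])
      (use c in \<open>auto simp: G_def w_def w'_def weyl_monomial_shift[OF uv] weyl_monomial_shift[OF uv']\<close>)
  ultimately show "\<exists>\<Phi>. ucp_map d d' \<Phi> \<and> \<Phi> u = u' \<and> \<Phi> v = v'" using \<Phi> by blast
qed

end
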